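(* Let $(a_n)_{n\ge 0}$ and $(b_n)_{n\ge 0}$ be sequences with $a_n\neq 0$ and $b_n\neq 0$ for all $n$, and let $t$ be an indeterminate. Let $(x_n)_{n\ge 0}$ be a sequence satisfying, for all $n\geq 0$, $$x_{n+2}=a_nx_{n+1}+b_nx_{n}.$$ Then the following two identities hold for every $n=0,1,2,\dots$, provided the denominators appearing in them are not $0$: $$\sum_{k=1}^n \frac{t^{k-1}}{a_0a_1\cdots a_{k-1}}\cdot\frac{b_{k-1}x_{k-1}+(t-1)x_{k+1}}{x_1}=\frac{t^n}{a_0a_1\cdots a_{n-1}}\cdot\frac{x_{n+1}}{x_1}-1,$$ $$\sum_{k=1}^n \frac{(-1)^k}{t^k}\cdot\frac{a_1a_2\cdots a_{k-1}}{b_1b_2\cdots b_k}\cdot\frac{x_{k+2}+(t-1)b_kx_{k}}{x_1}=\frac{(-1)^n}{t^n}\cdot\frac{a_1a_2\cdots a_{n}}{b_1b_2\cdots b_n}\cdot\frac{x_{n+1}}{x_1}-1.$$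
   Context: The entries of the sequences $a_n$, $b_n$ (and $x_n$), and $t$, are indeterminates that may be specialized to complex numbers or polynomials; the identities can thus be read in a field containing all these quantities. Empty products (such as $a_0\cdots a_{n-1}$ for $n=0$, or $a_1\cdots a_{k-1}$ for $k=1$) equal $1$, and empty sums equal $0$. *)

theory Defs
  imports Main
begin

end

theory Submission imports Defs begin

text \<open>Both sums telescope. Write F(n) for the right-hand side without its final -1; then F(0)
  = 1, since the products are empty and \<open>x 1 / x 1 = 1\<close>. The recurrence rewrites the
  numerator of the k-th summand so that the summand becomes F(k) - F(k-1). The two lemmas carry this
  out by induction, one per identity.\<close>

lemma recurrence_sum_shifted_up:
  fixes a b x :: "nat \<Rightarrow> 'a::field" and t :: 'a
  assumes a_nz: "\<And>n. a n \<noteq> 0"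
    and rec: "\<And>n. x (n + 2) = a n * x (n + 1) + b n * x n"
    and x1_nz: "x 1 \<noteq> 0"
  shows "(\<Sum>k=1..n. t ^ (k - 1) / (\<Prod>i=0..k-1. a i)
        * ((b (k - 1) * x (k - 1) + (t - 1) * x (k + 1)) / x 1))
      = t ^ n / (\<Prod>i=0..<n. a i) * (x (n + 1) / x 1) - 1"
proof (induction n)
  case 0
  show ?case using x1_nz by simp
next
  case (Suc n)
  define P where "P = (\<Prod>i=0..<n. a i)"
  have P: "P \<noteq> 0" using a_nz by (simp add: P_def)
  \<comment> \<open>The summand at \<open>k = Suc n\<close> has the closed range up to
    \<open>k - 1 = n\<close>, the right-hand side a half-open one that is empty for
    \<open>n = 0\<close>; here both give the same product.\<close>
  have prods: "(\<Prod>i=0..n. a i) = P * a n" "(\<Prod>i=0..<Suc n. a i) = P * a n"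
    by (simp_all add: P_def flip: atLeastLessThanSuc_atLeastAtMost)
  \<comment> \<open>Eliminating \<open>b n * x n\<close> by the recurrence leaves only
    \<open>x (n + 2)\<close> and \<open>x (n + 1)\<close>, the terms of F(n+1) and F(n).\<close>
  have num: "b n * x n + (t - 1) * x (n + 2) = t * x (n + 2) - a n * x (n + 1)"
    using rec[of n] by (simp add: algebra_simps)
  have "t ^ n / (P * a n) * ((t * x (n + 2) - a n * x (n + 1)) / x 1)
      = t ^ Suc n / (P * a n) * (x (n + 2) / x 1) - t ^ n / P * (x (n + 1) / x 1)"
    using P a_nz[of n] x1_nz by (simp add: field_simps)
  then show ?case
    using Suc.IH num prods by (simp add: P_def[symmetric])
qed

text \<open>Here the recurrence eliminates \<open>x (k + 2)\<close>, and the numerator becomes a sum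
  of two terms; the alternating sign turns it into the difference F(k) - F(k-1). Cancelling one
  factor \<open>t\<close> in the second term uses \<open>t_nz\<close>.\<close>

lemma recurrence_sum_shifted_down:
  fixes a b x :: "nat \<Rightarrow> 'a::field" and t :: 'a
  assumes b_nz: "\<And>n. b n \<noteq> 0"
    and rec: "\<And>n. x (n + 2) = a n * x (n + 1) + b n * x n"
    and x1_nz: "x 1 \<noteq> 0"
    and t_nz: "t \<noteq> 0"
  shows "(\<Sum>k=1..n. (-1) ^ k / t ^ k * ((\<Prod>i=1..k-1. a i) / (\<Prod>i=1..k. b i))
          * ((x (k + 2) + (t - 1) * b k * x k) / x 1))
        = (-1) ^ n / t ^ n * ((\<Prod>i=1..n. a i) / (\<Prod>i=1..n. b i)) * (x (n + 1) / x 1) - 1"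
proof (induction n)
  case 0
  show ?case using x1_nz by simp
next
  case (Suc n)
  define A where "A = (\<Prod>i=1..n. a i)"
  define B where "B = (\<Prod>i=1..n. b i)"
  \<comment> \<open>Naming the sign keeps it an atom while \<open>field_simps\<close> clears
    denominators.\<close>
  define s where "s = (-1 :: 'a) ^ n"
  have B: "B \<noteq> 0" using b_nz by (simp add: B_def)
  have prods: "(\<Prod>i=1..Suc n. a i) = A * a (Suc n)" "(\<Prod>i=1..Suc n. b i) = B * b (Suc n)"
    by (simp_all add: A_def B_def)
  have num: "x (Suc n + 2) + (t - 1) * b (Suc n) * x (Suc n)
      = a (Suc n) * x (Suc n + 1) + t * b (Suc n) * x (Suc n)"
    unfolding rec[of "Suc n"] by (simp add: algebra_simps)
  have step: "(-1) ^ Suc n / t ^ Suc n * (A / (B * b (Suc n)))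
        * ((a (Suc n) * x (Suc n + 1) + t * b (Suc n) * x (Suc n)) / x 1)
      = (-1) ^ Suc n / t ^ Suc n * (A * a (Suc n) / (B * b (Suc n))) * (x (Suc n + 1) / x 1)
        - (-1) ^ n / t ^ n * (A / B) * (x (n + 1) / x 1)"
    unfolding power_Suc s_def[symmetric] using B b_nz[of "Suc n"] x1_nz t_nz
    by (simp add: field_simps)
  have "(\<Sum>k=1..Suc n. (-1) ^ k / t ^ k * ((\<Prod>i=1..k-1. a i) / (\<Prod>i=1..k. b i))
          * ((x (k + 2) + (t - 1) * b k * x k) / x 1))
      = ((-1) ^ n / t ^ n * (A / B) * (x (n + 1) / x 1) - 1)
        + (-1) ^ Suc n / t ^ Suc n * (A / (B * b (Suc n)))
          * ((a (Suc n) * x (Suc n + 1) + t * b (Suc n) * x (Suc n)) / x 1)"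
    by (subst sum.nat_ivl_Suc', simp)
      (simp only: Suc.IH num prods diff_Suc_1 A_def[symmetric] B_def[symmetric] add.commute)
  then show ?case
    unfolding step prods by simp
qed

theorem theorem2p1:
  fixes a b x :: "nat \<Rightarrow> 'a::field" and t :: 'a
  assumes a_nz: "\<And>n. a n \<noteq> 0"
    and b_nz: "\<And>n. b n \<noteq> 0"
    and rec: "\<And>n. x (n + 2) = a n * x (n + 1) + b n * x n"
    and x1_nz: "x 1 \<noteq> 0"
  shows "\<forall>n.
    (\<Sum>k=1..n. t ^ (k - 1) / (\<Prod>i=0..k-1. a i)
        * ((b (k - 1) * x (k - 1) + (t - 1) * x (k + 1)) / x 1))
      = t ^ n / (\<Prod>i=0..<n. a i) * (x (n + 1) / x 1) - 1
    \<and>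
    (t \<noteq> 0 \<longrightarrow>
      (\<Sum>k=1..n. (-1) ^ k / t ^ k * ((\<Prod>i=1..k-1. a i) / (\<Prod>i=1..k. b i))
          * ((x (k + 2) + (t - 1) * b k * x k) / x 1))
        = (-1) ^ n / t ^ n * ((\<Prod>i=1..n. a i) / (\<Prod>i=1..n. b i)) * (x (n + 1) / x 1) - 1)"
  using recurrence_sum_shifted_up[of a x b, OF a_nz rec x1_nz]
    recurrence_sum_shifted_down[of b x a, OF b_nz rec x1_nz] by blast

end
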